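(* Let $a,b,c\in\mathbb{C}$ be noncollinear and let $T$ be the triangle with vertices $a,b,c$, with $\mathtt{B}_\triangle\neq0$. Let $K$ be the Gaussian curvature of the graph of $f(z)=(z-a)(z-b)(z-c)$, regarded as a function on the plane $\mathbb{C}\cong\mathbb{R}^2$. Then there exist two orthogonal lines $L_1$ and $L_2$ in the plane with $L_1\cap L_2=\{\mathtt{b}_\triangle\}$ such that $K$ has two local minima located on $L_1$, which are equidistant from the barycenter $\mathtt{b}_\triangle$; two saddle points located on $L_2$, which are also equidistant from $\mathtt{b}_\triangle$; and a global maximum at $\mathtt{b}_\triangle$.
   Context: Notation: $\mathtt{b}_\triangle=\frac{a+b+c}{3}$ is the barycenter of $T$, and $\mathtt{B}_\triangle=\mathtt{b}_\triangle^2-\frac{ab+ac+bc}{3}$. The graph $\Gamma(f)=\{(z,f(z)):z\in\mathbb{C}\}\subset\mathbb{C}^2\cong\mathbb{R}^4$ carries the metric induced from $\mathbb{R}^4$; its Gaussian curvature at $(z,f(z))$ is $$K(z)=-\frac{8}{81}\,\frac{|z-\mathtt{b}_\triangle|^2}{\left[\frac19+\left|(z-\mathtt{b}_\triangle)^2-\mathtt{B}_\triangle\right|^2\right]^3}.$$ *)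

theory Defs
  imports "HOL-Complex_Analysis.Complex_Analysis"
begin

definition induced_metric ::
  "('a::euclidean_space \<Rightarrow> 'b::real_inner) \<Rightarrow> 'a \<Rightarrow> 'a \<Rightarrow> 'a \<Rightarrow> real" where
  "induced_metric X p u v = frechet_derivative X (at p) u \<bullet> frechet_derivative X (at p) v"

text \<open>
  Here \<open>g p u v\<close> is a metric tensor on a coordinate domain. The vectors \<open>u\<close>, \<open>v\<close>, \<open>w\<close> stand for
  constant vector fields, so all brackets vanish and the Koszul formula has only three terms.
  \<open>levi_civita g p u v\<close> is the value at \<open>p\<close> of the covariant derivative of \<open>v\<close> along \<open>u\<close>.
\<close>

definition levi_civita ::
  "('a::euclidean_space \<Rightarrow> 'a \<Rightarrow> 'a \<Rightarrow> real) \<Rightarrow> 'a \<Rightarrow> 'a \<Rightarrow> 'a \<Rightarrow> 'a" where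
  "levi_civita g p u v = (THE x. \<forall>w. 2 * g p x w =
      frechet_derivative (\<lambda>q. g q v w) (at p) u
    + frechet_derivative (\<lambda>q. g q u w) (at p) v
    - frechet_derivative (\<lambda>q. g q u v) (at p) w)"

definition covariant_derivative ::
  "('a::euclidean_space \<Rightarrow> 'a \<Rightarrow> 'a \<Rightarrow> real) \<Rightarrow> 'a \<Rightarrow> ('a \<Rightarrow> 'a) \<Rightarrow> 'a \<Rightarrow> 'a" where
  "covariant_derivative g u Y p = frechet_derivative Y (at p) u + levi_civita g p u (Y p)"

definition riemann_curvature ::
  "('a::euclidean_space \<Rightarrow> 'a \<Rightarrow> 'a \<Rightarrow> real) \<Rightarrow> 'a \<Rightarrow> 'a \<Rightarrow> 'a \<Rightarrow> 'a \<Rightarrow> 'a" where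
  "riemann_curvature g p u v w =
      covariant_derivative g u (covariant_derivative g v (\<lambda>_. w)) p
    - covariant_derivative g v (covariant_derivative g u (\<lambda>_. w)) p"

text \<open>The sectional curvature of the tangent plane, computed in its real basis \<open>1\<close>, \<open>\<i>\<close>.\<close>

definition gaussian_curvature :: "(complex \<Rightarrow> complex \<Rightarrow> complex \<Rightarrow> real) \<Rightarrow> complex \<Rightarrow> real" where
  "gaussian_curvature g p =
    g p (riemann_curvature g p 1 \<i> \<i>) 1 / (g p 1 1 * g p \<i> \<i> - (g p 1 \<i>)\<^sup>2)"

definition graph_curvature :: "(complex \<Rightarrow> complex) \<Rightarrow> complex \<Rightarrow> real" where
  "graph_curvature f = gaussian_curvature (induced_metric (\<lambda>z. (z, f z)))"

definition barycenter :: "complex \<Rightarrow> complex \<Rightarrow> complex \<Rightarrow> complex" where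
  "barycenter a b c = (a + b + c) / 3"

definition B_triangle :: "complex \<Rightarrow> complex \<Rightarrow> complex \<Rightarrow> complex" where
  "B_triangle a b c = (barycenter a b c)\<^sup>2 - (a * b + a * c + b * c) / 3"

definition is_line :: "complex set \<Rightarrow> bool" where
  "is_line L \<longleftrightarrow> affine L \<and> aff_dim L = 1"

definition orthogonal_lines :: "complex set \<Rightarrow> complex set \<Rightarrow> bool" where
  "orthogonal_lines L M \<longleftrightarrow> is_line L \<and> is_line M \<and>
    (\<forall>p\<in>L. \<forall>q\<in>L. \<forall>r\<in>M. \<forall>s\<in>M. orthogonal (p - q) (r - s))"

definition local_min :: "(complex \<Rightarrow> real) \<Rightarrow> complex \<Rightarrow> bool" where
  "local_min K p \<longleftrightarrow> (\<forall>\<^sub>F z in nhds p. K p \<le> K z)"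

definition local_max :: "(complex \<Rightarrow> real) \<Rightarrow> complex \<Rightarrow> bool" where
  "local_max K p \<longleftrightarrow> (\<forall>\<^sub>F z in nhds p. K z \<le> K p)"

definition saddle_point :: "(complex \<Rightarrow> real) \<Rightarrow> complex \<Rightarrow> bool" where
  "saddle_point K p \<longleftrightarrow>
    (K has_derivative (\<lambda>_. 0)) (at p) \<and> \<not> local_min K p \<and> \<not> local_max K p"

lemma graph_curvature_holomorphic:
  assumes f: "\<And>z. (f has_field_derivative f1 z) (at z)"
      and f1: "\<And>z. (f1 has_field_derivative f2 z) (at z)"
      and f2: "\<And>z. (f2 has_field_derivative f3 z) (at z)"
  shows "graph_curvature f z = - 2 * (cmod (f2 z))\<^sup>2 / (1 + (cmod (f1 z))\<^sup>2) ^ 3"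
proof -
  define l where "l = (\<lambda>p. 1 + (cmod (f1 p))\<^sup>2)"
  have lpos: "l p > 0" for p unfolding l_def by (simp add: add_pos_nonneg)
  define g where "g = induced_metric (\<lambda>z. (z, f z))"
  define A where "A = (\<lambda>p. f2 p * cnj (f1 p) / of_real (l p))"
  have fd: "(f has_derivative (\<lambda>h. f1 p * h)) (at p)" for p
    using f by (simp add: has_field_derivative_def)
  have f1d: "(f1 has_derivative (\<lambda>h. f2 p * h)) (at p)" for p
    using f1 by (simp add: has_field_derivative_def)
  have f2d: "(f2 has_derivative (\<lambda>h. f3 p * h)) (at p)" for p
    using f2 by (simp add: has_field_derivative_def)
  have "frechet_derivative (\<lambda>z. (z, f z)) (at p) = (\<lambda>h. (h, f1 p * h))" for p
    by (rule frechet_derivative_at[symmetric]) (intro has_derivative_Pair has_derivative_ident fd)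
  then have g: "g p u v = l p * (u \<bullet> v)" for p u v
    unfolding g_def induced_metric_def l_def cmod_power2
    by (simp add: inner_complex_def power2_eq_square algebra_simps)
  have l_alt: "l = (\<lambda>p. 1 + f1 p \<bullet> f1 p)"
    unfolding l_def by (simp add: power2_norm_eq_inner)
  have ld: "(l has_derivative (\<lambda>h. 2 * (f1 p \<bullet> (f2 p * h)))) (at p)" for p
    unfolding l_alt by (rule derivative_eq_intros f1d refl | simp add: inner_commute)+
  have gd: "frechet_derivative (\<lambda>q. g q u v) (at p) w = 2 * (f1 p \<bullet> (f2 p * w)) * (u \<bullet> v)"
    for u v w p
  proof -
    have "((\<lambda>q. g q u v) has_derivative (\<lambda>w. 2 * (f1 p \<bullet> (f2 p * w)) * (u \<bullet> v))) (at p)"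
      unfolding g by (rule derivative_eq_intros ld refl | simp)+
    from frechet_derivative_at[OF this] show ?thesis by metis
  qed
  have lc: "levi_civita g p u v = A p * u * v" for p u v
    unfolding levi_civita_def gd
  proof (rule the_equality)
    have A: "of_real (l p) * (A p * u * v) = f2 p * cnj (f1 p) * u * v"
      using lpos[of p] unfolding A_def by simp
    have g': "g p x w = (of_real (l p) * x) \<bullet> w" for x w
      unfolding g by (simp add: inner_complex_def algebra_simps)
    show "\<forall>w. 2 * g p (A p * u * v) w = 2 * (f1 p \<bullet> (f2 p * u)) * (v \<bullet> w)
        + 2 * (f1 p \<bullet> (f2 p * v)) * (u \<bullet> w) - 2 * (f1 p \<bullet> (f2 p * w)) * (u \<bullet> v)"
      unfolding g' A by (simp add: inner_complex_def algebra_simps)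
    then show "x = A p * u * v" if "\<forall>w. 2 * g p x w = 2 * (f1 p \<bullet> (f2 p * u)) * (v \<bullet> w)
        + 2 * (f1 p \<bullet> (f2 p * v)) * (u \<bullet> w) - 2 * (f1 p \<bullet> (f2 p * w)) * (u \<bullet> v)" for x
    proof -
      have "\<forall>w. 2 * g p x w = 2 * g p (A p * u * v) w"
        using that \<open>\<forall>w. 2 * g p (A p * u * v) w = _ w\<close> by simp
      then have "\<forall>w. x \<bullet> w = (A p * u * v) \<bullet> w"
        using lpos[of p] unfolding g by simp
      then show ?thesis by (metis vector_eq_rdot)
    qed
  qed
  define A' where "A' = (\<lambda>p h. (f3 p * h * cnj (f1 p) + f2 p * cnj (f2 p * h)) / of_real (l p)
     - f2 p * cnj (f1 p) * of_real (2 * (f1 p \<bullet> (f2 p * h))) / (of_real (l p))\<^sup>2)"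
  have Ad: "(A has_derivative A' p) (at p)" for p
    unfolding A_def A'_def
    using lpos[of p]
    by (auto intro!: derivative_eq_intros f1d f2d ld simp: field_simps power2_eq_square)
  have c1: "covariant_derivative g v (\<lambda>_. w) = (\<lambda>p. A p * v * w)" for v w
    unfolding covariant_derivative_def lc by (simp add: frechet_derivative_const)
  have c2: "covariant_derivative g u (\<lambda>p. A p * v * w) p = A' p u * v * w + A p * u * (A p * v * w)"
    for u v w p
  proof -
    have "((\<lambda>p. A p * v * w) has_derivative (\<lambda>h. A' p h * v * w)) (at p)"
      by (rule derivative_eq_intros Ad refl | simp)+
    from frechet_derivative_at[OF this]
    have "frechet_derivative (\<lambda>p. A p * v * w) (at p) u = A' p u * v * w" by metis
    then show ?thesis unfolding covariant_derivative_def lc by simp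
  qed
  have R: "riemann_curvature g z 1 \<i> \<i> = - (A' z 1 + \<i> * A' z \<i>)"
    unfolding riemann_curvature_def c1 c2 by (simp add: algebra_simps)
  have fin: "A' z 1 + \<i> * A' z \<i> = of_real (2 * (cmod (f2 z))\<^sup>2 / (l z)\<^sup>2)"
  proof -
    have lc: "complex_of_real (l z) = 1 + f1 z * cnj (f1 z)"
      unfolding l_def by (simp only: of_real_add of_real_1 complex_norm_square)
    have ll: "complex_of_real (l z) \<noteq> 0" using lpos[of z] by simp
    have i1: "of_real (2 * (f1 z \<bullet> (f2 z * h))) = f1 z * cnj (f2 z * h) + cnj (f1 z) * (f2 z * h)" for h
      by (simp add: inner_complex_def complex_eq_iff algebra_simps)
    have "(of_real (l z))\<^sup>2 * (A' z 1 + \<i> * A' z \<i>) = 2 * (f2 z * cnj (f2 z))"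
      unfolding A'_def i1 using ll
      apply (simp add: field_simps power2_eq_square)
      apply (simp add: lc algebra_simps)
      done
    also have "\<dots> = of_real (2 * (cmod (f2 z))\<^sup>2)"
      by (simp only: of_real_mult complex_norm_square of_real_numeral)
    finally show ?thesis using ll by (simp add: field_simps)
  qed
  have "graph_curvature f z = - 2 * (cmod (f2 z))\<^sup>2 / l z ^ 3"
    unfolding graph_curvature_def gaussian_curvature_def g_def[symmetric] R fin
    unfolding g using lpos[of z]
    by (simp add: inner_complex_def field_simps power2_eq_square power3_eq_cube)
  then show ?thesis by (simp add: l_def)
qed

lemma graph_curvature_cubic:
  "graph_curvature (\<lambda>z. (z - a) * (z - b) * (z - c)) z =
    - (8 / 81) * ((cmod (z - barycenter a b c))\<^sup>2 /
      (1 / 9 + (cmod ((z - barycenter a b c)\<^sup>2 - B_triangle a b c))\<^sup>2) ^ 3)"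
proof -
  define w where "w = (\<lambda>z. z - barycenter a b c)"
  define n where "n = (cmod ((w z)\<^sup>2 - B_triangle a b c))\<^sup>2"
  have "graph_curvature (\<lambda>z. (z - a) * (z - b) * (z - c)) z =
      - 2 * (cmod (6 * w z))\<^sup>2 / (1 + (cmod (3 * ((w z)\<^sup>2 - B_triangle a b c)))\<^sup>2) ^ 3"
  proof (rule graph_curvature_holomorphic)
    show "((\<lambda>z. (z - a) * (z - b) * (z - c)) has_field_derivative
        3 * ((w z)\<^sup>2 - B_triangle a b c)) (at z)" for z
      unfolding w_def B_triangle_def barycenter_def
      by (auto intro!: derivative_eq_intros simp: field_simps power2_eq_square)
    show "((\<lambda>z. 3 * ((w z)\<^sup>2 - B_triangle a b c)) has_field_derivative 6 * w z) (at z)" for z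
      unfolding w_def by (auto intro!: derivative_eq_intros)
    show "((\<lambda>z. 6 * w z) has_field_derivative 6) (at z)" for z
      unfolding w_def by (auto intro!: derivative_eq_intros)
  qed
  also have "\<dots> = - 72 * (cmod (w z))\<^sup>2 / (9 * (1 / 9 + n)) ^ 3"
    unfolding n_def norm_mult power_mult_distrib[of _ _ 2] by simp
  also have "\<dots> = - (8 / 81) * ((cmod (w z))\<^sup>2 / (1 / 9 + n) ^ 3)"
    by (simp only: power_mult_distrib[of 9]) (simp add: field_simps)
  finally show ?thesis unfolding w_def n_def .
qed

end

theory Submission
  imports Defs
begin

text \<open>
  Everything rests on the closed form of the curvature. Since \<open>B_triangle\<close> is a non-zero complex
  number, it has the form \<open>R u\<^sup>2\<close> with \<open>R > 0\<close> and \<open>\<bar>u\<bar> = 1\<close>. In the rotated coordinate \<open>w\<close> with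
  \<open>z = barycenter + u w\<close> the curvature is a negative multiple of
  \<open>\<rho> / (1/9 + \<bar>w\<^sup>2 - R\<bar>\<^sup>2)\<^sup>3\<close>, where \<open>\<rho> = \<bar>w\<bar>\<^sup>2\<close>, and the two lines are the axes of this coordinate.

  The numerator depends on \<open>\<rho>\<close> only, and on the circle \<open>\<bar>w\<bar>\<^sup>2 = \<rho>\<close> the denominator lies between its
  values on the two axes, where \<open>\<bar>w\<^sup>2 - R\<bar>\<close> is \<open>\<bar>\<rho> - R\<bar>\<close> (real axis) or \<open>\<rho> + R\<close> (imaginary axis).
  On either axis it is therefore a one-variable problem: maximise \<open>\<rho> / (1/9 + (\<rho> - c)\<^sup>2)\<^sup>3\<close> for
  \<open>c = R\<close> or \<open>c = - R\<close>. There is a unique maximiser, the positive root of a quadratic equation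
  (\<open>axis_profile_less\<close>). For \<open>c = R\<close> it gives the absolute minimum of the curvature. For \<open>c = - R\<close>
  the curvature is minimal along the axis, but it decreases along the circle through the point:
  a saddle. The only other zero of the gradient is the origin
  (\<open>model_curvature_critical_iff\<close>), where the curvature is zero and hence maximal; so the lists
  of minima and of saddle points are complete.
\<close>

section \<open>The one-variable problem on an axis\<close>

text \<open>
  The positive root of \<open>5 \<rho>\<^sup>2 - 4 c \<rho> - c\<^sup>2 - 1/9 = 0\<close>, which is the equation for a critical point of
  \<open>\<rho> / (1/9 + (\<rho> - c)\<^sup>2)\<^sup>3\<close>.
\<close>

definition axis_root :: "real \<Rightarrow> real" where
  "axis_root c = (2 * c + sqrt (9 * c\<^sup>2 + 5 / 9)) / 5"

lemma axis_root_pos: "axis_root c > 0"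
proof -
  have "\<bar>2 * c\<bar> < sqrt (9 * c\<^sup>2 + 5 / 9)"
    by (rule real_less_rsqrt) (simp add: power_mult_distrib add_nonneg_pos)
  then show ?thesis unfolding axis_root_def by simp
qed

lemma axis_root_eq: "1 / 9 + (axis_root c - c)\<^sup>2 = 6 * axis_root c * (axis_root c - c)"
proof -
  define s where "s = sqrt (9 * c\<^sup>2 + 5 / 9)"
  have s2: "s * s = 9 * c * c + 5 / 9"
    unfolding s_def by (simp add: power2_eq_square add_nonneg_nonneg)
  show ?thesis
    unfolding axis_root_def s_def[symmetric] power2_eq_square
    using s2 by (simp add: field_simps)
qed

text \<open>The quadratic equation has roots of opposite sign, so positivity singles one out.\<close>

lemma axis_root_unique:
  assumes "\<rho> > 0" and "1 / 9 + (\<rho> - c)\<^sup>2 = 6 * \<rho> * (\<rho> - c)"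
  shows "\<rho> = axis_root c"
proof -
  define r where "r = axis_root c"
  have r: "r > 0" "1 / 9 + (r - c)\<^sup>2 = 6 * r * (r - c)"
    unfolding r_def by (rule axis_root_pos axis_root_eq)+
  have "r * \<rho> * (5 * (\<rho> - r)) + (1 / 9 + c\<^sup>2) * (\<rho> - r) = 0"
  proof -
    have "5 * \<rho>\<^sup>2 - 4 * c * \<rho> = c\<^sup>2 + 1 / 9" "5 * r\<^sup>2 - 4 * c * r = c\<^sup>2 + 1 / 9"
      using assms(2) r(2) by (simp_all add: power2_eq_square algebra_simps)
    then have "r * (5 * \<rho>\<^sup>2 - 4 * c * \<rho>) - \<rho> * (5 * r\<^sup>2 - 4 * c * r) = (r - \<rho>) * (c\<^sup>2 + 1 / 9)"
      by (simp only: left_diff_distrib)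
    then show ?thesis by (simp add: power2_eq_square field_simps)
  qed
  then have "(5 * (r * \<rho>) + (1 / 9 + c\<^sup>2)) * (\<rho> - r) = 0"
    by (simp add: algebra_simps)
  moreover have "5 * (r * \<rho>) + (1 / 9 + c\<^sup>2) > 0"
    using r(1) assms(1) by (simp add: add_pos_nonneg)
  ultimately show ?thesis by (simp add: r_def)
qed

text \<open>
  The equation for \<open>r = axis_root c\<close> says that the tangent at \<open>r\<close> of the convex function
  \<open>N \<rho> = 1/9 + (\<rho> - c)\<^sup>2\<close> is \<open>N r (2 + \<rho>/r) / 3\<close>. Cubing, the claim is reduced to
  \<open>(2 + t)\<^sup>3 > 27 t\<close> for \<open>t = \<rho>/r \<noteq> 1\<close>, the inequality of the arithmetic and geometric means
  of \<open>1, 1, t\<close>.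
\<close>

lemma axis_profile_less:
  assumes "\<rho> \<ge> 0" and "\<rho> \<noteq> axis_root c"
  shows "\<rho> / (1 / 9 + (\<rho> - c)\<^sup>2) ^ 3
    < axis_root c / (1 / 9 + (axis_root c - c)\<^sup>2) ^ 3"
proof -
  define r where "r = axis_root c"
  define N where "N = (\<lambda>x. 1 / 9 + (x - c)\<^sup>2)"
  define t where "t = \<rho> / r"
  have r: "r > 0" "N r = 6 * r * (r - c)"
    unfolding r_def N_def by (rule axis_root_pos axis_root_eq)+
  have Npos: "N x > 0" for x unfolding N_def by (simp add: add_pos_nonneg)
  have t: "t \<ge> 0" "t \<noteq> 1" "\<rho> = t * r"
    using r(1) assms unfolding t_def r_def by simp_all
  have "N \<rho> = N r + 2 * (r - c) * (\<rho> - r) + (\<rho> - r)\<^sup>2"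
    unfolding N_def by (simp add: power2_eq_square algebra_simps)
  also have "2 * (r - c) * (\<rho> - r) = N r * (t - 1) / 3"
    unfolding r(2) t(3) by (simp add: algebra_simps)
  finally have "N r * ((2 + t) / 3) \<le> N \<rho>" by (simp add: field_simps)
  then have "(N r * ((2 + t) / 3)) ^ 3 \<le> N \<rho> ^ 3"
    using Npos[of r] t(1) by (intro power_mono) auto
  moreover have "t * N r ^ 3 < (N r * ((2 + t) / 3)) ^ 3"
  proof -
    have "0 < (t - 1)\<^sup>2 * (t + 8)" using t by simp
    then have "t < ((2 + t) / 3) ^ 3"
      by (simp add: power2_eq_square power3_eq_cube field_simps)
    then have "t * N r ^ 3 < ((2 + t) / 3) ^ 3 * N r ^ 3"
      using Npos[of r] by (intro mult_strict_right_mono) auto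
    then show ?thesis by (simp only: power_mult_distrib mult.commute)
  qed
  ultimately have "t * N r ^ 3 < N \<rho> ^ 3" by linarith
  then have "\<rho> * N r ^ 3 < r * N \<rho> ^ 3"
    using r(1) unfolding t(3) by (simp add: algebra_simps)
  then have "\<rho> / N \<rho> ^ 3 < r / N r ^ 3"
    using Npos[of r] Npos[of \<rho>] by (simp add: field_simps)
  then show ?thesis unfolding r_def N_def .
qed

section \<open>Detecting extrema along curves\<close>

lemma not_local_min_along:
  assumes "(\<gamma> \<longlongrightarrow> p) F" and "F \<noteq> bot" and "\<forall>\<^sub>F t in F. K (\<gamma> t) < K p"
  shows "\<not> local_min K p"
proof
  assume "local_min K p"
  then have "\<forall>\<^sub>F t in F. K p \<le> K (\<gamma> t)"
    unfolding local_min_def by (rule eventually_compose_filterlim) fact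
  with assms(3) have "\<forall>\<^sub>F t in F. False" by eventually_elim simp
  with assms(2) show False by simp
qed

lemma not_local_max_along:
  assumes "(\<gamma> \<longlongrightarrow> p) F" and "F \<noteq> bot" and "\<forall>\<^sub>F t in F. K p < K (\<gamma> t)"
  shows "\<not> local_max K p"
proof
  assume "local_max K p"
  then have "\<forall>\<^sub>F t in F. K (\<gamma> t) \<le> K p"
    unfolding local_max_def by (rule eventually_compose_filterlim) fact
  with assms(3) have "\<forall>\<^sub>F t in F. False" by eventually_elim simp
  with assms(2) show False by simp
qed

lemma local_min_derivative_zero:
  assumes "local_min K p" and "(K has_derivative K') (at p)"
  shows "K' = (\<lambda>_. 0)"
proof -
  obtain S where "open S" "p \<in> S" "\<forall>z\<in>S. K p \<le> K z"
    using assms(1) unfolding local_min_def eventually_nhds by blast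
  then show ?thesis using differential_zero_maxmin[OF _ _ assms(2)] by blast
qed

section \<open>The curvature in the rotated coordinate\<close>

text \<open>
  The curvature for a triangle with barycenter \<open>0\<close> and \<open>B_triangle\<close> equal to the real number \<open>R\<close>.
\<close>

definition model_curvature :: "real \<Rightarrow> complex \<Rightarrow> real" where
  "model_curvature R w =
    - (8 / 81) * ((cmod w)\<^sup>2 / (1 / 9 + (cmod (w\<^sup>2 - of_real R))\<^sup>2) ^ 3)"

lemma model_curvature_nonpos: "model_curvature R w \<le> 0"
  unfolding model_curvature_def by (simp add: divide_nonneg_nonneg)

lemma model_curvature_0 [simp]: "model_curvature R 0 = 0"
  by (simp add: model_curvature_def)

lemma model_curvature_neg:
  assumes "w \<noteq> 0" shows "model_curvature R w < 0"
proof -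
  have "1 / 9 + (cmod (w\<^sup>2 - of_real R))\<^sup>2 > 0" by (simp add: add_pos_nonneg)
  then show ?thesis using assms unfolding model_curvature_def by simp
qed

text \<open>
  On a circle about the origin only the last summand varies. The first form compares a point with
  the points of its circle on the real axis, the second with those on the imaginary axis.
\<close>

lemma cmod_square_minus_real:
  "(cmod (w\<^sup>2 - of_real R))\<^sup>2 = ((cmod w)\<^sup>2 - R)\<^sup>2 + 4 * R * (Im w)\<^sup>2"
  "(cmod (w\<^sup>2 - of_real R))\<^sup>2 = ((cmod w)\<^sup>2 + R)\<^sup>2 - 4 * R * (Re w)\<^sup>2"
  unfolding cmod_power2 by (simp_all add: power2_eq_square algebra_simps)

lemma model_curvature_imaginary:
  "model_curvature R (\<i> * of_real t) = - (8 / 81) * (t\<^sup>2 / (1 / 9 + (t\<^sup>2 + R)\<^sup>2) ^ 3)"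
  unfolding model_curvature_def cmod_square_minus_real(2) by (simp add: norm_mult)

lemma model_curvature_global_min:
  assumes "R > 0" and "(cmod p)\<^sup>2 = axis_root R" and "Im p = 0"
  shows "model_curvature R p \<le> model_curvature R w"
proof -
  define r where "r = (cmod w)\<^sup>2"
  have "r / (1 / 9 + (cmod (w\<^sup>2 - of_real R))\<^sup>2) ^ 3 \<le> r / (1 / 9 + (r - R)\<^sup>2) ^ 3"
    using assms(1) unfolding cmod_square_minus_real(1) r_def
    by (intro divide_left_mono power_mono mult_pos_pos zero_less_power) (auto simp: add_pos_nonneg)
  also have "\<dots> \<le> axis_root R / (1 / 9 + (axis_root R - R)\<^sup>2) ^ 3"
    using axis_profile_less[of r R] by (cases "r = axis_root R") (auto simp: r_def)
  also have "\<dots> = axis_root R / (1 / 9 + (cmod (p\<^sup>2 - of_real R))\<^sup>2) ^ 3"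
    unfolding cmod_square_minus_real(1) using assms(2,3) by simp
  finally show ?thesis unfolding model_curvature_def r_def assms(2) by simp
qed

lemma model_curvature_less_on_circle:
  assumes "R > 0" and "cmod w = cmod q" and "q \<noteq> 0" and "Re q = 0" and "Re w \<noteq> 0"
  shows "model_curvature R w < model_curvature R q"
proof -
  have pos: "1 / 9 + (cmod (v\<^sup>2 - of_real R))\<^sup>2 > 0" for v by (simp add: add_pos_nonneg)
  have "(cmod (w\<^sup>2 - of_real R))\<^sup>2 < (cmod (q\<^sup>2 - of_real R))\<^sup>2"
    using assms unfolding cmod_square_minus_real(2) by simp
  then have "(1 / 9 + (cmod (w\<^sup>2 - of_real R))\<^sup>2) ^ 3 < (1 / 9 + (cmod (q\<^sup>2 - of_real R))\<^sup>2) ^ 3"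
    using pos[of w] by (intro power_strict_mono) auto
  then show ?thesis
    unfolding model_curvature_def assms(2)
    using assms(3) pos[of w] pos[of q] by (simp add: divide_strict_left_mono)
qed

text \<open>
  Up to a common factor, the components of the gradient are \<open>Re w\<close> and \<open>Im w\<close>, each times the
  difference of the two sides of an equation which, on the respective axis, is that of \<open>axis_root\<close>.
\<close>

lemma model_curvature_has_derivative:
  defines "\<rho> \<equiv> \<lambda>w. (cmod w)\<^sup>2" and "N \<equiv> \<lambda>R w. 1 / 9 + (cmod (w\<^sup>2 - complex_of_real R))\<^sup>2"
  shows "(model_curvature R has_derivative (\<lambda>h. - (16 / 81) / N R w ^ 4 *
      (Re w * (N R w - 6 * \<rho> w * (\<rho> w - R)) * Re h
     + Im w * (N R w - 6 * \<rho> w * (\<rho> w + R)) * Im h))) (at w)"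
proof -
  have Npos: "N R w > 0" for w unfolding N_def by (simp add: add_pos_nonneg)
  have \<rho>: "\<rho> = (\<lambda>w. (Re w)\<^sup>2 + (Im w)\<^sup>2)" unfolding \<rho>_def cmod_power2 ..
  have N: "N R = (\<lambda>w. 1 / 9 + (\<rho> w - R)\<^sup>2 + 4 * R * (Im w)\<^sup>2)"
    unfolding N_def \<rho>_def cmod_square_minus_real(1) by (simp add: add.assoc)
  define \<rho>' where "\<rho>' = (\<lambda>h. 2 * Re w * Re h + 2 * Im w * Im h)"
  define N' where "N' = (\<lambda>h. 4 * Re w * (\<rho> w - R) * Re h + 4 * Im w * (\<rho> w + R) * Im h)"
  have d\<rho>: "(\<rho> has_derivative \<rho>') (at w)"
    unfolding \<rho> \<rho>'_def by (auto intro!: derivative_eq_intros)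
  have dN: "(N R has_derivative N') (at w)"
    unfolding N N'_def
    by (rule derivative_eq_intros d\<rho> refl)+ (simp add: \<rho>'_def fun_eq_iff algebra_simps)
  have K: "model_curvature R = (\<lambda>w. - (8 / 81) * (\<rho> w / N R w ^ 3))"
    unfolding model_curvature_def[abs_def] N_def \<rho>_def ..
  have "(model_curvature R has_derivative
      (\<lambda>h. - (8 / 81) * ((\<rho>' h * N R w ^ 3 - \<rho> w * (3 * N' h * N R w ^ 2)) / (N R w ^ 3 * N R w ^ 3)))) (at w)"
    unfolding K using Npos[of w]
    by (auto intro!: derivative_eq_intros d\<rho> dN simp: fun_eq_iff field_simps)
  moreover have "- (8 / 81) * ((\<rho>' h * N R w ^ 3 - \<rho> w * (3 * N' h * N R w ^ 2)) / (N R w ^ 3 * N R w ^ 3))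
     = - (16 / 81) / N R w ^ 4 * (Re w * (N R w - 6 * \<rho> w * (\<rho> w - R)) * Re h
     + Im w * (N R w - 6 * \<rho> w * (\<rho> w + R)) * Im h)" for h
  proof -
    define n where "n = N R w"
    have "n > 0" unfolding n_def by (rule Npos)
    then have "(\<rho>' h * n ^ 3 - \<rho> w * (3 * N' h * n ^ 2)) / (n ^ 3 * n ^ 3)
        = (\<rho>' h * n - 3 * \<rho> w * N' h) / n ^ 4"
      by (simp add: field_simps eval_nat_numeral)
    moreover have "\<rho>' h * n - 3 * \<rho> w * N' h = 2 * (Re w * (n - 6 * \<rho> w * (\<rho> w - R)) * Re h
     + Im w * (n - 6 * \<rho> w * (\<rho> w + R)) * Im h)"
      unfolding \<rho>'_def N'_def by (simp add: algebra_simps)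
    ultimately show ?thesis unfolding n_def[symmetric] by simp
  qed
  ultimately show ?thesis by simp
qed

text \<open>
  Off the axes both brackets of the gradient would have to vanish, and their difference is
  \<open>12 R \<rho>\<close>. On an axis what remains is the equation of \<open>axis_root\<close>.
\<close>

lemma model_curvature_critical_iff:
  assumes "R > 0"
  shows "(model_curvature R has_derivative (\<lambda>_. 0)) (at w) \<longleftrightarrow>
    w \<in> {0, of_real (sqrt (axis_root R)), - of_real (sqrt (axis_root R)),
         \<i> * of_real (sqrt (axis_root (- R))), - (\<i> * of_real (sqrt (axis_root (- R))))}"
proof -
  define x y where "x = Re w" and "y = Im w"
  define \<rho> where "\<rho> = (cmod w)\<^sup>2"
  define n where "n = 1 / 9 + (cmod (w\<^sup>2 - complex_of_real R))\<^sup>2"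
  define D where "D = (\<lambda>h. - (16 / 81) / n ^ 4 *
      (x * (n - 6 * \<rho> * (\<rho> - R)) * Re h + y * (n - 6 * \<rho> * (\<rho> + R)) * Im h))"
  have npos: "n > 0" unfolding n_def by (simp add: add_pos_nonneg)
  have \<rho>: "\<rho> = x\<^sup>2 + y\<^sup>2" unfolding \<rho>_def x_def y_def cmod_power2 ..
  have w: "w = Complex x y" by (simp add: x_def y_def)
  have n1: "n = 1 / 9 + (\<rho> - R)\<^sup>2 + 4 * R * y\<^sup>2" and n2: "n = 1 / 9 + (\<rho> + R)\<^sup>2 - 4 * R * x\<^sup>2"
    using cmod_square_minus_real[where w = w and R = R] by (simp_all add: n_def \<rho>_def x_def y_def)
  have D: "(model_curvature R has_derivative D) (at w)"
    unfolding D_def n_def \<rho>_def x_def y_def by (rule model_curvature_has_derivative)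
  have "(model_curvature R has_derivative (\<lambda>_. 0)) (at w) \<longleftrightarrow> D = (\<lambda>_. 0)"
    using D has_derivative_unique[OF D] by metis
  also have "\<dots> \<longleftrightarrow> x * (n - 6 * \<rho> * (\<rho> - R)) = 0 \<and> y * (n - 6 * \<rho> * (\<rho> + R)) = 0"
  proof
    assume "D = (\<lambda>_. 0)"
    then have "D 1 = 0" "D \<i> = 0" by simp_all
    then show "x * (n - 6 * \<rho> * (\<rho> - R)) = 0 \<and> y * (n - 6 * \<rho> * (\<rho> + R)) = 0"
      using npos unfolding D_def by simp
  next
    assume "x * (n - 6 * \<rho> * (\<rho> - R)) = 0 \<and> y * (n - 6 * \<rho> * (\<rho> + R)) = 0"
    then show "D = (\<lambda>_. 0)"
      unfolding D_def by (simp only: mult_zero_left mult_zero_right add_0_left)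
  qed
  also have "\<dots> \<longleftrightarrow> x = 0 \<and> y = 0 \<or> y = 0 \<and> x\<^sup>2 = axis_root R \<or> x = 0 \<and> y\<^sup>2 = axis_root (- R)"
  proof
    assume *: "x * (n - 6 * \<rho> * (\<rho> - R)) = 0 \<and> y * (n - 6 * \<rho> * (\<rho> + R)) = 0"
    consider "x = 0" "y = 0" | "x \<noteq> 0" "y = 0" | "x = 0" "y \<noteq> 0" | "x \<noteq> 0" "y \<noteq> 0" by blast
    then show "x = 0 \<and> y = 0 \<or> y = 0 \<and> x\<^sup>2 = axis_root R \<or> x = 0 \<and> y\<^sup>2 = axis_root (- R)"
    proof cases
      case 2
      then have "x\<^sup>2 = axis_root R"
        using * n1 by (intro axis_root_unique) (auto simp: \<rho>)
      with 2 show ?thesis by simp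
    next
      case 3
      then have "y\<^sup>2 = axis_root (- R)"
        using * n2 by (intro axis_root_unique) (auto simp: \<rho>)
      with 3 show ?thesis by simp
    next
      case 4
      then have "n = 6 * \<rho> * (\<rho> - R)" "n = 6 * \<rho> * (\<rho> + R)" using * by auto
      then have "R * \<rho> = 0" by (simp add: algebra_simps)
      then show ?thesis using assms 4 by (simp add: \<rho> sum_power2_eq_zero_iff)
    qed simp
  next
    assume "x = 0 \<and> y = 0 \<or> y = 0 \<and> x\<^sup>2 = axis_root R \<or> x = 0 \<and> y\<^sup>2 = axis_root (- R)"
    then show "x * (n - 6 * \<rho> * (\<rho> - R)) = 0 \<and> y * (n - 6 * \<rho> * (\<rho> + R)) = 0"
      using axis_root_eq[of R] axis_root_eq[of "- R"] n1 n2 by (auto simp: \<rho>)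
  qed
  also have "\<dots> \<longleftrightarrow> x = 0 \<and> y = 0 \<or> y = 0 \<and> (x = sqrt (axis_root R) \<or> x = - sqrt (axis_root R))
      \<or> x = 0 \<and> (y = sqrt (axis_root (- R)) \<or> y = - sqrt (axis_root (- R)))"
  proof -
    have "t\<^sup>2 = axis_root c \<longleftrightarrow> t = sqrt (axis_root c) \<or> t = - sqrt (axis_root c)" for t c
      using axis_root_pos[of c] power2_eq_iff[of t "sqrt (axis_root c)"] by simp
    then show ?thesis by simp
  qed
  finally show ?thesis by (auto simp: w complex_eq_iff)
qed

lemma model_curvature_local_min_iff_saddle_iff:
  assumes "R > 0"
  shows "local_min (model_curvature R) w \<longleftrightarrow>
      w \<in> {of_real (sqrt (axis_root R)), - of_real (sqrt (axis_root R))}" (is "_ \<longleftrightarrow> w \<in> ?P")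
    and "saddle_point (model_curvature R) w \<longleftrightarrow>
      w \<in> {\<i> * of_real (sqrt (axis_root (- R))), - (\<i> * of_real (sqrt (axis_root (- R))))}"
      (is "_ \<longleftrightarrow> w \<in> ?Q")
proof -
  let ?K = "model_curvature R"
  have crit: "(?K has_derivative (\<lambda>_. 0)) (at w) \<longleftrightarrow> w \<in> {0} \<union> ?P \<union> ?Q" for w
    unfolding model_curvature_critical_iff[OF assms] by auto
  have min: "local_min ?K p" if "p \<in> ?P" for p
  proof -
    have "(cmod p)\<^sup>2 = axis_root R" "Im p = 0" using that axis_root_pos[of R] by auto
    then show ?thesis
      unfolding local_min_def using model_curvature_global_min[OF assms] by simp
  qed
  have origin_max: "local_max ?K 0"
    unfolding local_max_def by (simp add: model_curvature_nonpos)
  have origin_not_min: "\<not> local_min ?K 0"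
  proof (rule not_local_min_along)
    show "((\<lambda>w. w) \<longlongrightarrow> 0) (at (0::complex))" by (rule tendsto_ident_at)
    show "\<forall>\<^sub>F w in at 0. ?K w < ?K 0"
      by (auto simp: eventually_at_filter model_curvature_neg)
  qed simp
  have saddle: "\<not> local_min ?K q \<and> \<not> local_max ?K q" if "q \<in> ?Q" for q
  proof
    obtain s where s: "q = \<i> * of_real s" "s\<^sup>2 = axis_root (- R)"
    proof (cases "q = \<i> * of_real (sqrt (axis_root (- R)))")
      case True
      then show ?thesis using axis_root_pos[of "- R"] that by simp
    next
      case False
      then have "q = \<i> * of_real (- sqrt (axis_root (- R)))" using \<open>q \<in> ?Q\<close> by simp
      moreover have "(- sqrt (axis_root (- R)))\<^sup>2 = axis_root (- R)"
        using axis_root_pos[of "- R"] by simp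
      ultimately show ?thesis using that by blast
    qed
    have "s \<noteq> 0" using s(2) axis_root_pos[of "- R"] by auto
    \<comment> \<open>Along the circle through \<open>q\<close> the curvature drops; along the axis it rises.\<close>
    show "\<not> local_min ?K q"
    proof (rule not_local_min_along)
      have "((\<lambda>t. q * cis t) \<longlongrightarrow> q * cis 0) (at_right 0)"
        unfolding cis_conv_exp by (intro tendsto_intros)
      then show "((\<lambda>t. q * cis t) \<longlongrightarrow> q) (at_right 0)" by simp
      have "\<forall>\<^sub>F t in at_right 0. t \<in> {0<..<pi}" by (rule eventually_at_right_real) simp
      then show "\<forall>\<^sub>F t in at_right 0. ?K (q * cis t) < ?K q"
      proof eventually_elim
        case (elim t)
        then have "sin t > 0" by (intro sin_gt_zero) auto
        then show ?case
          using \<open>s \<noteq> 0\<close> s(1) by (intro model_curvature_less_on_circle assms) (auto simp: norm_mult)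
      qed
    qed simp
    show "\<not> local_max ?K q"
    proof (rule not_local_max_along)
      show "((\<lambda>t. \<i> * complex_of_real t) \<longlongrightarrow> q) (at s)"
        unfolding s(1) by (intro tendsto_intros)
      have "\<forall>\<^sub>F t in at s. t \<noteq> s \<and> t \<noteq> - s"
        by (intro eventually_conj eventually_neq_at_within)
      then show "\<forall>\<^sub>F t in at s. ?K q < ?K (\<i> * of_real t)"
      proof eventually_elim
        case (elim t)
        then have "t\<^sup>2 \<noteq> axis_root (- R)"
          unfolding s(2)[symmetric] by (simp add: power2_eq_iff)
        from axis_profile_less[OF _ this] show ?case
          unfolding s(1) model_curvature_imaginary s(2) by simp
      qed
    qed simp
  qed
  show "local_min ?K w \<longleftrightarrow> w \<in> ?P"
  proof
    assume *: "local_min ?K w"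
    obtain K' where "(?K has_derivative K') (at w)"
      using model_curvature_has_derivative by blast
    moreover from this have "K' = (\<lambda>_. 0)" by (rule local_min_derivative_zero[OF *])
    ultimately have "w \<in> {0} \<union> ?P \<union> ?Q" using crit by simp
    with * origin_not_min saddle show "w \<in> ?P" by blast
  qed (rule min)
  show "saddle_point ?K w \<longleftrightarrow> w \<in> ?Q"
    unfolding saddle_point_def crit using min origin_max saddle by blast
qed

section \<open>Rotating back\<close>

lemma nhds_affine_complex:
  fixes u b w :: complex
  assumes "u \<noteq> 0"
  shows "nhds (b + u * w) = filtermap (\<lambda>w. b + u * w) (nhds w)"
proof -
  have "filtermap (\<lambda>w. b + u * w) (nhds w) = filtermap (\<lambda>w. w + b) (filtermap (\<lambda>w. u * w) (nhds w))"
    by (simp add: filtermap_filtermap add.commute)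
  also have "\<dots> = nhds (b + u * w)"
    using assms by (simp add: filtermap_nhds_times filtermap_nhds_shift[of "-b", simplified] add.commute)
  finally show ?thesis ..
qed

lemma local_extremum_affine_iff:
  assumes "u \<noteq> 0"
  shows "local_min K (b + u * w) \<longleftrightarrow> local_min (\<lambda>w. K (b + u * w)) w"
    and "local_max K (b + u * w) \<longleftrightarrow> local_max (\<lambda>w. K (b + u * w)) w"
  unfolding local_min_def local_max_def nhds_affine_complex[OF assms] eventually_filtermap by simp_all

lemma saddle_point_affine_iff:
  assumes "u \<noteq> 0"
  shows "saddle_point K (b + u * w) \<longleftrightarrow> saddle_point (\<lambda>w. K (b + u * w)) w"
proof -
  have "(K has_derivative (\<lambda>_. 0)) (at (b + u * w)) \<longleftrightarrow>
      ((\<lambda>w. K (b + u * w)) has_derivative (\<lambda>_. 0)) (at w)"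
  proof
    assume "(K has_derivative (\<lambda>_. 0)) (at (b + u * w))"
    moreover have "((\<lambda>w. b + u * w) has_derivative (\<lambda>h. u * h)) (at w)"
      by (auto intro!: derivative_eq_intros)
    ultimately show "((\<lambda>w. K (b + u * w)) has_derivative (\<lambda>_. 0)) (at w)"
      using has_derivative_compose by blast
  next
    assume "((\<lambda>w. K (b + u * w)) has_derivative (\<lambda>_. 0)) (at w)"
    then have "((\<lambda>w. K (b + u * w)) has_derivative (\<lambda>_. 0)) (at (((b + u * w) - b) / u))"
      using assms by simp
    moreover have "((\<lambda>z. (z - b) / u) has_derivative (\<lambda>h. h / u)) (at (b + u * w))"
      using assms by (auto intro!: derivative_eq_intros)
    ultimately have "((\<lambda>z. K (b + u * ((z - b) / u))) has_derivative (\<lambda>_. 0)) (at (b + u * w))"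
      using has_derivative_compose by blast
    then show "(K has_derivative (\<lambda>_. 0)) (at (b + u * w))" using assms by simp
  qed
  then show ?thesis unfolding saddle_point_def local_extremum_affine_iff[OF assms] by simp
qed

lemma is_line_range:
  assumes "u \<noteq> 0" shows "is_line (range (\<lambda>t. b + of_real t * u))"
proof -
  have "range (\<lambda>t. b + of_real t * u) = affine hull {b, b + u}"
    by (simp add: affine_hull_2_alt scaleR_conv_of_real)
  then show ?thesis
    unfolding is_line_def using assms by (simp add: affine_affine_hull)
qed

theorem theorem3p5:
  fixes a b c :: complex and K :: "complex \<Rightarrow> real"
  assumes "\<not> collinear {a, b, c}"
      and "B_triangle a b c \<noteq> 0"
      and "K = graph_curvature (\<lambda>z. (z - a) * (z - b) * (z - c))"
  shows "\<exists>L1 L2. orthogonal_lines L1 L2 \<and> L1 \<inter> L2 = {barycenter a b c} \<and>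
    (\<exists>p1 p2. p1 \<noteq> p2 \<and> {z. local_min K z} = {p1, p2} \<and> p1 \<in> L1 \<and> p2 \<in> L1 \<and>
       dist p1 (barycenter a b c) = dist p2 (barycenter a b c)) \<and>
    (\<exists>q1 q2. q1 \<noteq> q2 \<and> {z. saddle_point K z} = {q1, q2} \<and> q1 \<in> L2 \<and> q2 \<in> L2 \<and>
       dist q1 (barycenter a b c) = dist q2 (barycenter a b c)) \<and>
    (\<forall>z. K z \<le> K (barycenter a b c))"
proof -
  define g where "g = barycenter a b c"
  define B where "B = B_triangle a b c"
  define R where "R = cmod B"
  \<comment> \<open>The minima lie in the direction of the square roots of \<open>B\<close>, the critical points of the cubic
    being \<open>g \<plusminus> csqrt B\<close>.\<close>
  define u where "u = sgn (csqrt B)"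
  have "B \<noteq> 0" using assms(2) by (simp add: B_def)
  then have R: "R > 0" and u1: "cmod u = 1" and u: "u \<noteq> 0"
    by (simp_all add: R_def u_def norm_sgn sgn_zero_iff)
  have B: "B = of_real R * u\<^sup>2"
  proof -
    have "csqrt B = of_real (cmod (csqrt B)) * u"
      using \<open>B \<noteq> 0\<close> by (simp add: u_def sgn_div_norm scaleR_conv_of_real)
    then have "(csqrt B)\<^sup>2 = of_real ((cmod (csqrt B))\<^sup>2) * u\<^sup>2"
      by (metis power_mult_distrib of_real_power)
    then show ?thesis by (simp add: R_def norm_power[symmetric])
  qed
  have K: "K (g + u * w) = model_curvature R w" for w
  proof -
    have "(u * w)\<^sup>2 - B = u\<^sup>2 * (w\<^sup>2 - of_real R)"
      unfolding B by (simp add: algebra_simps power_mult_distrib)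
    then have "cmod ((u * w)\<^sup>2 - B) = cmod (w\<^sup>2 - of_real R)"
      by (simp add: norm_mult norm_power u1)
    then show ?thesis
      unfolding assms(3) graph_curvature_cubic model_curvature_def g_def[symmetric] B_def[symmetric]
      by (simp add: norm_mult u1)
  qed
  have z: "z = g + u * ((z - g) / u)" for z using u by simp
  define s t where "s = sqrt (axis_root R)" and "t = sqrt (axis_root (- R))"
  have st: "s > 0" "t > 0" using axis_root_pos by (simp_all add: s_def t_def)
  define L1 L2 where "L1 = range (\<lambda>x. g + of_real x * u)"
    and "L2 = range (\<lambda>x. g + of_real x * (\<i> * u))"
  have min: "local_min K (g + u * w) \<longleftrightarrow> w = of_real s \<or> w = - of_real s" for w
    unfolding local_extremum_affine_iff[OF u] K
    using model_curvature_local_min_iff_saddle_iff(1)[OF R] by (simp add: s_def)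
  have saddle: "saddle_point K (g + u * w) \<longleftrightarrow> w = \<i> * of_real t \<or> w = - (\<i> * of_real t)" for w
    unfolding saddle_point_affine_iff[OF u] K
    using model_curvature_local_min_iff_saddle_iff(2)[OF R] by (simp add: t_def)
  have "orthogonal_lines L1 L2"
  proof -
    have "is_line L1" "is_line L2" unfolding L1_def L2_def using u by (simp_all add: is_line_range)
    moreover have "orthogonal (p - q) (p' - q')" if "p \<in> L1" "q \<in> L1" "p' \<in> L2" "q' \<in> L2" for p q p' q'
      using that unfolding L1_def L2_def
      by (auto simp: orthogonal_def inner_complex_def algebra_simps)
    ultimately show ?thesis unfolding orthogonal_lines_def by blast
  qed
  moreover have "L1 \<inter> L2 = {g}"
  proof -
    have "g \<in> L1" "g \<in> L2" unfolding L1_def L2_def by (auto intro!: image_eqI[of _ _ 0])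
    moreover have "z = g" if z1: "z \<in> L1" and z2: "z \<in> L2" for z
    proof -
      obtain x where "z = g + of_real x * u"
        using z1 unfolding L1_def by blast
      moreover obtain y where "z = g + of_real y * (\<i> * u)"
        using z2 unfolding L2_def by blast
      ultimately have "z = g + of_real x * u" and "complex_of_real x = of_real y * \<i>"
        using u by simp_all
      then show ?thesis by (simp add: complex_eq_iff)
    qed
    ultimately show ?thesis by blast
  qed
  moreover have "\<exists>p1 p2. p1 \<noteq> p2 \<and> {z. local_min K z} = {p1, p2} \<and> p1 \<in> L1 \<and> p2 \<in> L1 \<and>
       dist p1 g = dist p2 g"
  proof (intro exI conjI)
    show "g + of_real s * u \<noteq> g + of_real (- s) * u" using u st by simp
    show "{z. local_min K z} = {g + of_real s * u, g + of_real (- s) * u}"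
    proof (rule set_eqI)
      fix z
      have "local_min K z \<longleftrightarrow> (z - g) / u = of_real s \<or> (z - g) / u = - of_real s"
        using min[of "(z - g) / u"] z[of z] by simp
      then show "z \<in> {z. local_min K z} \<longleftrightarrow> z \<in> {g + of_real s * u, g + of_real (- s) * u}"
        using u by (auto simp: field_simps)
    qed
    show "dist (g + of_real s * u) g = dist (g + of_real (- s) * u) g"
      by (simp add: dist_norm norm_mult)
  qed (unfold L1_def, (rule rangeI)+)
  moreover have "\<exists>q1 q2. q1 \<noteq> q2 \<and> {z. saddle_point K z} = {q1, q2} \<and> q1 \<in> L2 \<and> q2 \<in> L2 \<and>
       dist q1 g = dist q2 g"
  proof (intro exI conjI)
    show "g + of_real t * (\<i> * u) \<noteq> g + of_real (- t) * (\<i> * u)" using u st by simp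
    show "{z. saddle_point K z} = {g + of_real t * (\<i> * u), g + of_real (- t) * (\<i> * u)}"
    proof (rule set_eqI)
      fix z
      have "saddle_point K z \<longleftrightarrow> (z - g) / u = \<i> * of_real t \<or> (z - g) / u = - (\<i> * of_real t)"
        using saddle[of "(z - g) / u"] z[of z] by simp
      then show "z \<in> {z. saddle_point K z} \<longleftrightarrow>
          z \<in> {g + of_real t * (\<i> * u), g + of_real (- t) * (\<i> * u)}"
        using u by (auto simp: field_simps)
    qed
    show "dist (g + of_real t * (\<i> * u)) g = dist (g + of_real (- t) * (\<i> * u)) g"
      by (simp add: dist_norm norm_mult)
  qed (unfold L2_def, (rule rangeI)+)
  moreover have "K z \<le> K g" for z
    using K[of "(z - g) / u"] K[of 0] z[of z] model_curvature_nonpos[of R "(z - g) / u"] by simp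
  ultimately show ?thesis unfolding g_def[symmetric] by blast
qed

end
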